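(* Let $(X_\infty,f_\infty)$ be a topological NDS with an IMS $\mu_\infty$. Assume that there exists a sequence $(\mathcal{R}^k_\infty)_{k=0}^\infty$ with $\mathcal{R}^k_\infty\in\mathcal{E}_{\mathrm M}(\mu_\infty)$ for all $k$ such that $\lim_{k\to\infty}\operatorname{diam}\mathcal{R}^k_\infty=0$. Then the metric entropy satisfies $$h(f_\infty,\mu_\infty)=\sup_{k\ge0}h(f_\infty,\mu_\infty;\mathcal{R}^k_\infty)=\lim_{k\to\infty}h(f_\infty,\mu_\infty;\mathcal{R}^k_\infty).$$
   Context: A topological nonautonomous dynamical system (topological NDS) $(X_\infty,f_\infty)$ consists of a sequence $X_\infty=(X_n)_{n\ge0}$ of nonempty compact metric spaces $(X_n,d_n)$ and an equicontinuous sequence $f_\infty=(f_n)_{n\ge0}$ of maps $f_n:X_n\to X_{n+1}$, i.e. for every $\varepsilon>0$ there is $\delta>0$ such that for all $n\ge0$ and $x,y\in X_n$, $d_n(x,y)<\delta$ implies $d_{n+1}(f_n(x),f_n(y))<\varepsilon$. Put $f_k^n:=f_{k+n-1}\circ\cdots\circ f_k$ for $n\ge1$, $f_k^0:=\mathrm{id}_{X_k}$, and $f_k^{-n}:=(f_k^n)^{-1}$ (applied to sets only). An invariant measure sequence (IMS) is a sequence $\mu_\infty=(\mu_n)_{n\ge0}$ of Borel probability measures $\mu_n$ on $X_n$ with $f_n\mu_n=\mu_{n+1}$ (push-forward) for all $n$. $\mathcal{E}_{\mathrm M}(\mu_\infty)$ is the family of admissible sequences: a sequence $\mathcal{P}_\infty=(\mathcal{P}_n)_{n\ge0}$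 of finite Borel partitions $\mathcal{P}_n=\{P_{n,1},\dots,P_{n,k_n}\}$ of $X_n$ is in $\mathcal{E}_{\mathrm M}(\mu_\infty)$ iff $(k_n)$ is bounded and for each $\varepsilon>0$ there are $\delta>0$ and compact (possibly empty) sets $K_{n,i}\subset P_{n,i}$ such that for all $n\ge0$: (a) $\mu_n(P_{n,i}\setminus K_{n,i})\le\varepsilon$ for $i=1,\dots,k_n$; (b) for $1\le i<j\le k_n$, $d_n(x,y)\ge\delta$ for all $x\in K_{n,i}$, $y\in K_{n,j}$. For a sequence $\mathcal{P}_\infty$ of finite Borel partitions, $h(f_\infty,\mu_\infty;\mathcal{P}_\infty):=\limsup_{n\to\infty}\frac1nH_{\mu_0}\big(\bigvee_{i=0}^{n-1}f_0^{-i}\mathcal{P}_i\big)$ with $H_\mu(\mathcal{P})=-\sum_{P\in\mathcal{P}}\mu(P)\log\mu(P)$. The metric entropy is $h(f_\infty,\mu_\infty):=\sup_{\mathcal{P}_\infty\in\mathcal{E}_{\mathrm M}(\mu_\infty)}h(f_\infty,\mu_\infty;\mathcal{P}_\infty)$. The diameter of a sequence of partitions is $\operatorname{diam}\mathcal{P}_\infty:=\sup_{n\ge0}\sup_{P\in\mathcal{P}_n}\operatorname{diam}P$, with $\operatorname{diam}P=\sup_{x,y\in P}d_n(x,y)$. *)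

theory Defs
  imports "HOL-Probability.Probability_Measure" "HOL-Library.Disjoint_Sets"
begin

text \<open>
  The spaces are values of the type \<open>'a metric\<close>, each with its own carrier
  \<open>mspace (X n) :: 'a set\<close> and its own distance \<open>mdist (X n)\<close>. The common type \<open>'a\<close> of points
  is no restriction: every sequence of metric spaces can be realised on
  pairwise disjoint subsets of a single type.
\<close>

definition borel_of_metric :: "'a metric \<Rightarrow> 'a measure" where
  "borel_of_metric m = sigma (mspace m) {U. openin (mtopology_of m) U}"

definition equicontinuous_seq :: "(nat \<Rightarrow> 'a metric) \<Rightarrow> (nat \<Rightarrow> 'a \<Rightarrow> 'a) \<Rightarrow> bool" where
  "equicontinuous_seq X f \<longleftrightarrow>
     (\<forall>\<epsilon>>0. \<exists>\<delta>>0. \<forall>n. \<forall>x\<in>mspace (X n). \<forall>y\<in>mspace (X n).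
        mdist (X n) x y < \<delta> \<longrightarrow> mdist (X (Suc n)) (f n x) (f n y) < \<epsilon>)"

definition topological_NDS :: "(nat \<Rightarrow> 'a metric) \<Rightarrow> (nat \<Rightarrow> 'a \<Rightarrow> 'a) \<Rightarrow> bool" where
  "topological_NDS X f \<longleftrightarrow>
     (\<forall>n. mspace (X n) \<noteq> {} \<and> compact_space (mtopology_of (X n))) \<and>
     (\<forall>n. f n \<in> mspace (X n) \<rightarrow> mspace (X (Suc n))) \<and>
     equicontinuous_seq X f"

definition invariant_measure_seq ::
  "(nat \<Rightarrow> 'a metric) \<Rightarrow> (nat \<Rightarrow> 'a \<Rightarrow> 'a) \<Rightarrow> (nat \<Rightarrow> 'a measure) \<Rightarrow> bool" where
  "invariant_measure_seq X f \<mu> \<longleftrightarrow>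
     (\<forall>n. prob_space (\<mu> n) \<and> space (\<mu> n) = mspace (X n) \<and>
          sets (\<mu> n) = sets (borel_of_metric (X n))) \<and>
     (\<forall>n. distr (\<mu> n) (\<mu> (Suc n)) (f n) = \<mu> (Suc n))"

text \<open>
  \<open>nds_iter f k n\<close> is $f_k^n$, a map from \<open>X k\<close> to \<open>X (k + n)\<close>.
\<close>

primrec nds_iter :: "(nat \<Rightarrow> 'a \<Rightarrow> 'a) \<Rightarrow> nat \<Rightarrow> nat \<Rightarrow> 'a \<Rightarrow> 'a" where
  "nds_iter f k 0 = id"
| "nds_iter f k (Suc n) = f (k + n) \<circ> nds_iter f k n"

text \<open>
  Partitions are sets of nonempty sets, as in \<^const>\<open>partition_on\<close>; dropping empty members
  of a partition affects neither admissibility nor entropy nor diameter.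
\<close>

definition finite_borel_partition :: "'a metric \<Rightarrow> 'a set set \<Rightarrow> bool" where
  "finite_borel_partition m P \<longleftrightarrow>
     finite P \<and> partition_on (mspace m) P \<and> P \<subseteq> sets (borel_of_metric m)"

text \<open>
  The members of each partition index themselves, so \<open>K n A\<close> is the compact set $K_{n,i}$
  belonging to $A = P_{n,i}$.
\<close>

definition admissible_seqs ::
  "(nat \<Rightarrow> 'a metric) \<Rightarrow> (nat \<Rightarrow> 'a measure) \<Rightarrow> (nat \<Rightarrow> 'a set set) set" where
  "admissible_seqs X \<mu> =
     {P. (\<forall>n. finite_borel_partition (X n) (P n)) \<and>
         (\<exists>N. \<forall>n. card (P n) \<le> N) \<and>
         (\<forall>\<epsilon>>0. \<exists>\<delta>>0. \<exists>K :: nat \<Rightarrow> 'a set \<Rightarrow> 'a set. \<forall>n.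
            (\<forall>A\<in>P n. K n A \<subseteq> A \<and> compactin (mtopology_of (X n)) (K n A) \<and>
                     measure (\<mu> n) (A - K n A) \<le> \<epsilon>) \<and>
            (\<forall>A\<in>P n. \<forall>B\<in>P n. A \<noteq> B \<longrightarrow>
               (\<forall>x\<in>K n A. \<forall>y\<in>K n B. mdist (X n) x y \<ge> \<delta>)))}"

definition pullback_partition :: "'a set \<Rightarrow> ('a \<Rightarrow> 'b) \<Rightarrow> 'b set set \<Rightarrow> 'a set set" where
  "pullback_partition S g P = (\<lambda>A. g -` A \<inter> S) ` P - {{}}"

text \<open>
  Since \<open>ln 0 = 0\<close> in HOL, null sets contribute $0$, which is the convention $0 \log 0 = 0$.
\<close>

definition partition_entropy :: "'a measure \<Rightarrow> 'a set set \<Rightarrow> real" where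
  "partition_entropy M P = - (\<Sum>A\<in>P. measure M A * ln (measure M A))"

definition joined_partition ::
  "(nat \<Rightarrow> 'a metric) \<Rightarrow> (nat \<Rightarrow> 'a \<Rightarrow> 'a) \<Rightarrow> (nat \<Rightarrow> 'a set set) \<Rightarrow> nat \<Rightarrow> 'a set set" where
  "joined_partition X f P n =
     common_refinement ((\<lambda>i. pullback_partition (mspace (X 0)) (nds_iter f 0 i) (P i)) ` {..<n})"

definition entropy_wrt ::
  "(nat \<Rightarrow> 'a metric) \<Rightarrow> (nat \<Rightarrow> 'a \<Rightarrow> 'a) \<Rightarrow> (nat \<Rightarrow> 'a measure) \<Rightarrow> (nat \<Rightarrow> 'a set set) \<Rightarrow> ereal" where
  "entropy_wrt X f \<mu> P =
     limsup (\<lambda>n. ereal (1 / real n * partition_entropy (\<mu> 0) (joined_partition X f P n)))"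

definition metric_entropy ::
  "(nat \<Rightarrow> 'a metric) \<Rightarrow> (nat \<Rightarrow> 'a \<Rightarrow> 'a) \<Rightarrow> (nat \<Rightarrow> 'a measure) \<Rightarrow> ereal" where
  "metric_entropy X f \<mu> = (SUP P\<in>admissible_seqs X \<mu>. entropy_wrt X f \<mu> P)"

text \<open>
  Extended-real valued because the diameters of the spaces need not be bounded in \<open>n\<close>.
\<close>

definition metric_diam :: "'a metric \<Rightarrow> 'a set \<Rightarrow> ereal" where
  "metric_diam m A = (SUP (x, y)\<in>A \<times> A. ereal (mdist m x y))"

definition diam_seq :: "(nat \<Rightarrow> 'a metric) \<Rightarrow> (nat \<Rightarrow> 'a set set) \<Rightarrow> ereal" where
  "diam_seq X P = (SUP n. SUP A\<in>P n. metric_diam (X n) A)"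

end

theory Submission
  imports Defs "HOL-Probability.Information"
begin

text \<open>
  Fix an admissible \<open>P\<close> and let \<open>K n A\<close> be the \<open>\<delta>\<close>-separated compact sets that approximate its members.
  If the diameter of \<open>R k\<close> is below \<open>\<delta>\<close>, each member of \<open>R k n\<close> meets at most one \<open>K n A\<close>, so it
  determines the member of \<open>P n\<close> up to a small error probability; by Fano's inequality the
  conditional entropy of \<open>P n\<close> given \<open>R k n\<close> is small uniformly in \<open>n\<close>. Submodularity of entropy then
  bounds the entropy of the joined partition of \<open>P\<close> by that of \<open>R k\<close> plus \<open>n * \<epsilon>\<close>. Hence every
  \<open>entropy_wrt X f \<mu> P\<close> is at most the limit inferior of \<open>entropy_wrt X f \<mu> (R k)\<close>.
\<close>

section \<open>Entropy of simple random variables\<close>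

text \<open>Shannon entropy of the law of \<open>X\<close>, in natural units. With partitions
  replaced by their labelling maps, a join becomes a tuple and a coarsening becomes a
  composition.\<close>

definition rv_entropy :: "'a measure \<Rightarrow> ('a \<Rightarrow> 'b) \<Rightarrow> real" where
  "rv_entropy M X =
     - (\<Sum>v\<in>X ` space M. measure M (X -` {v} \<inter> space M) * ln (measure M (X -` {v} \<inter> space M)))"

lemma partition_entropy_fibres:
  "partition_entropy M ((\<lambda>v. X -` {v} \<inter> space M) ` X ` space M) = rv_entropy M X"
proof -
  have "inj_on (\<lambda>v. X -` {v} \<inter> space M) (X ` space M)"
    by (rule inj_onI) auto
  then show ?thesis
    by (simp add: partition_entropy_def rv_entropy_def sum.reindex o_def)
qed

context prob_space
begin

text \<open>The expectation of \<open>g (h X)\<close>, computed from the law of \<open>X\<close> and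
  from that of \<open>h X\<close>: a fibre of \<open>h X\<close> is the disjoint union of the fibres
  of \<open>X\<close> over the values that \<open>h\<close> identifies.\<close>

lemma sum_prob_fibres_comp:
  fixes g :: "'c \<Rightarrow> real"
  assumes X: "simple_function M X"
  shows "(\<Sum>v\<in>X ` space M. prob (X -` {v} \<inter> space M) * g (h v)) =
    (\<Sum>w\<in>(\<lambda>x. h (X x)) ` space M. prob ((\<lambda>x. h (X x)) -` {w} \<inter> space M) * g w)"
proof -
  note fin = simple_functionD(1)[OF X]
  have P: "prob ((\<lambda>x. h (X x)) -` {w} \<inter> space M) =
      (\<Sum>v\<in>{v \<in> X ` space M. h v = w}. prob (X -` {v} \<inter> space M))" for w
  proof -
    have "(\<lambda>x. h (X x)) -` {w} \<inter> space M =
        (\<Union>v\<in>{v \<in> X ` space M. h v = w}. X -` {v} \<inter> space M)"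
      by auto
    then show ?thesis
      using fin simple_functionD(2)[OF X]
      by (simp only:, intro finite_measure_finite_Union) (auto simp: disjoint_family_on_def)
  qed
  have "(\<Sum>v\<in>X ` space M. prob (X -` {v} \<inter> space M) * g (h v)) =
      (\<Sum>w\<in>h ` X ` space M. \<Sum>v\<in>{v \<in> X ` space M. h v = w}. prob (X -` {v} \<inter> space M) * g (h v))"
    by (rule sum.image_gen[OF fin])
  also have "\<dots> = (\<Sum>w\<in>h ` X ` space M. prob ((\<lambda>x. h (X x)) -` {w} \<inter> space M) * g w)"
    by (intro sum.cong refl) (simp add: P sum_distrib_right)
  finally show ?thesis
    by (simp add: image_image)
qed

lemma sum_prob_fibres:
  assumes X: "simple_function M X"
  shows "(\<Sum>v\<in>X ` space M. prob (X -` {v} \<inter> space M)) = 1"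
  using sum_prob_fibres_comp[OF X, of "\<lambda>_. 1" "\<lambda>_. True"] not_empty prob_space
  by (simp add: image_constant_conv)

lemma prob_fibre_comp_mono:
  assumes "simple_function M X"
  shows "prob (X -` {v} \<inter> space M) \<le> prob ((\<lambda>x. h (X x)) -` {h v} \<inter> space M)"
  using simple_functionD(2)[OF simple_function_compose1[OF assms, of h]]
  by (intro finite_measure_mono) auto

text \<open>Puts the entropies of all functions of \<open>X\<close> over one index set, the values
  of \<open>X\<close>, so that they can be compared term by term.\<close>

lemma rv_entropy_comp:
  assumes X: "simple_function M X"
  shows "rv_entropy M (\<lambda>x. h (X x)) =
    - (\<Sum>v\<in>X ` space M. prob (X -` {v} \<inter> space M) * ln (prob ((\<lambda>x. h (X x)) -` {h v} \<inter> space M)))"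
  unfolding rv_entropy_def
  using sum_prob_fibres_comp[OF X, of "\<lambda>w. ln (prob ((\<lambda>x. h (X x)) -` {w} \<inter> space M))" h]
  by simp

lemma rv_entropy_comp_le:
  assumes X: "simple_function M X"
  shows "rv_entropy M (\<lambda>x. h (X x)) \<le> rv_entropy M X"
proof -
  have "prob (X -` {v} \<inter> space M) * ln (prob (X -` {v} \<inter> space M)) \<le>
      prob (X -` {v} \<inter> space M) * ln (prob ((\<lambda>x. h (X x)) -` {h v} \<inter> space M))" for v
  \<comment> \<open>Since \<open>ln 0 = 0\<close>, the logarithm is monotone only on positive
    arguments; null fibres are harmless because of the factor in front.\<close>
  proof (cases "prob (X -` {v} \<inter> space M) = 0")
    case False
    then have "0 < prob (X -` {v} \<inter> space M)"
      using measure_nonneg[of M "X -` {v} \<inter> space M"] by linarith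
    then show ?thesis
      using prob_fibre_comp_mono[OF X, of v h] by (intro mult_left_mono ln_mono) auto
  qed simp
  then show ?thesis
    unfolding rv_entropy_comp[OF X] unfolding rv_entropy_def by (simp add: sum_mono)
qed

text \<open>The right side minus the left is the conditional mutual information of \<open>X\<close>
  and \<open>Y\<close> given \<open>Z\<close>, which is nonnegative.\<close>

lemma rv_entropy_submodular:
  assumes X: "simple_function M X" and Y: "simple_function M Y" and Z: "simple_function M Z"
  shows "rv_entropy M (\<lambda>x. (X x, Y x, Z x)) + rv_entropy M Z \<le>
    rv_entropy M (\<lambda>x. (X x, Z x)) + rv_entropy M (\<lambda>x. (Y x, Z x))"
proof -
  \<comment> \<open>Base \<open>exp 1\<close> turns the logarithm of the information library into
    \<open>ln\<close>.\<close>
  interpret information_space M "exp 1"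
    by unfold_locales simp
  define W where "W = (\<lambda>x. (X x, Y x, Z x))"
  have W: "simple_function M W"
    unfolding W_def by (intro simple_function_Pair X Y Z)
  note sd = simple_distributedI[OF _ measure_nonneg refl]
  define pw where "pw v = prob (W -` {v} \<inter> space M)" for v
  define pxz where "pxz v = prob ((\<lambda>x. (X x, Z x)) -` {v} \<inter> space M)" for v
  define pyz where "pyz v = prob ((\<lambda>x. (Y x, Z x)) -` {v} \<inter> space M)" for v
  define pz where "pz v = prob (Z -` {v} \<inter> space M)" for v
  \<comment> \<open>Each marginal dominates \<open>pw\<close>, so where \<open>pw\<close> is
    positive every factor is and the logarithm splits; elsewhere both sides vanish.\<close>
  have pointwise: "pw (x, y, z) * ln (pw (x, y, z) / (pxz (x, z) * (pyz (y, z) / pz z))) =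
      pw (x, y, z) * ln (pw (x, y, z)) + pw (x, y, z) * ln (pz z)
      - pw (x, y, z) * ln (pxz (x, z)) - pw (x, y, z) * ln (pyz (y, z))" for x y z
  proof (cases "pw (x, y, z) = 0")
    case False
    then have pos: "0 < pw (x, y, z)"
      unfolding pw_def using measure_nonneg by (metis less_eq_real_def)
    have "pw (x, y, z) \<le> pxz (x, z)" "pw (x, y, z) \<le> pyz (y, z)" "pw (x, y, z) \<le> pz z"
      using prob_fibre_comp_mono[OF W, of "(x, y, z)" "\<lambda>(x, y, z). (x, z)"]
        prob_fibre_comp_mono[OF W, of "(x, y, z)" "\<lambda>(x, y, z). (y, z)"]
        prob_fibre_comp_mono[OF W, of "(x, y, z)" "\<lambda>(x, y, z). z"]
      unfolding pw_def pxz_def pyz_def pz_def by (simp_all add: W_def)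
    with pos have "0 < pxz (x, z)" "0 < pyz (y, z)" "0 < pz z"
      by linarith+
    with pos show ?thesis
      by (simp add: ln_div ln_mult algebra_simps)
  qed simp
  have "0 \<le> conditional_mutual_information (exp 1) (count_space (X ` space M))
      (count_space (Y ` space M)) (count_space (Z ` space M)) X Y Z"
    by (rule conditional_mutual_information_nonneg[OF X Y Z])
  also have "\<dots> =
      (\<Sum>(x, y, z)\<in>W ` space M. pw (x, y, z) * ln (pw (x, y, z) / (pxz (x, z) * (pyz (y, z) / pz z))))"
    unfolding pw_def pxz_def pyz_def pz_def W_def log_ln
    by (rule conditional_mutual_information_eq[OF sd sd sd sd])
      (intro simple_function_Pair X Y Z)+
  also have "\<dots> = (\<Sum>(x, y, z)\<in>W ` space M. pw (x, y, z) * ln (pw (x, y, z)) + pw (x, y, z) * ln (pz z)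
      - pw (x, y, z) * ln (pxz (x, z)) - pw (x, y, z) * ln (pyz (y, z)))"
    by (simp only: pointwise)
  also have "\<dots> = - rv_entropy M W - rv_entropy M Z
      + rv_entropy M (\<lambda>x. (X x, Z x)) + rv_entropy M (\<lambda>x. (Y x, Z x))"
    using rv_entropy_comp[OF W, of "\<lambda>(x, y, z). (x, z)"]
      rv_entropy_comp[OF W, of "\<lambda>(x, y, z). (y, z)"]
      rv_entropy_comp[OF W, of "\<lambda>(x, y, z). z"]
    unfolding pw_def pxz_def pyz_def pz_def rv_entropy_def[of M W]
    by (simp add: W_def case_prod_unfold sum.distrib sum_subtractf)
  finally show ?thesis
    by (simp add: W_def)
qed

text \<open>Tuples of variable length \<open>n\<close> are encoded as functions that are
  \<open>undefined\<close> from \<open>n\<close> on, so a longer tuple is a function update of a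
  shorter one.\<close>

lemma simple_function_tuple:
  assumes "\<And>i. simple_function M (F i)"
  shows "simple_function M (\<lambda>x. restrict (\<lambda>i. F i x) {..<n :: nat})"
proof (induction n)
  case (Suc n)
  have "(\<lambda>x. restrict (\<lambda>i. F i x) {..<Suc n}) =
      (\<lambda>x. (\<lambda>(u, v). u(n := v)) (restrict (\<lambda>i. F i x) {..<n}, F n x))"
    by (auto simp: fun_eq_iff restrict_def)
  then show ?case
    using simple_function_compose1[OF simple_function_Pair[OF Suc assms], of "\<lambda>(u, v). u(n := v)" n]
    by (simp only:)
qed simp

text \<open>The summands are the conditional entropies of \<open>F i\<close> given
  \<open>G i\<close>. The induction runs on the joint entropy of both tuples, which dominates that
  of the \<open>F\<close>-tuple alone.\<close>

lemma rv_entropy_tuple_le: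
  fixes F :: "nat \<Rightarrow> 'a \<Rightarrow> 'b" and G :: "nat \<Rightarrow> 'a \<Rightarrow> 'c"
  assumes F: "\<And>i. simple_function M (F i)" and G: "\<And>i. simple_function M (G i)"
  shows "rv_entropy M (\<lambda>x. restrict (\<lambda>i. F i x) {..<n}) \<le>
    rv_entropy M (\<lambda>x. restrict (\<lambda>i. G i x) {..<n}) +
    (\<Sum>i<n. rv_entropy M (\<lambda>x. (F i x, G i x)) - rv_entropy M (G i))"
proof -
  define TF where "TF n x = restrict (\<lambda>i. F i x) {..<n}" for n x
  define TG where "TG n x = restrict (\<lambda>i. G i x) {..<n}" for n x
  have sTF: "simple_function M (TF n)" and sTG: "simple_function M (TG n)" for n
    unfolding TF_def[abs_def] TG_def[abs_def] using F G by (intro simple_function_tuple; simp)+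
  have TF_Suc: "TF (Suc n) x = (TF n x)(n := F n x)" and TG_Suc: "TG (Suc n) x = (TG n x)(n := G n x)"
    for n x by (auto simp: TF_def TG_def fun_eq_iff restrict_def)
  have TG_proj: "TG n x = restrict (TG (Suc n) x) {..<n}" "G n x = TG (Suc n) x n" for n x
    by (auto simp: TG_def fun_eq_iff restrict_def)
  have "rv_entropy M (\<lambda>x. (TF n x, TG n x)) \<le> rv_entropy M (TG n) +
    (\<Sum>i<n. rv_entropy M (\<lambda>x. (F i x, G i x)) - rv_entropy M (G i))"
  proof (induction n)
    \<comment> \<open>Both empty tuples are the constant \<open>\<lambda>_. undefined\<close>, so
      the pair is a function of the second component.\<close>
    case 0
    show ?case
      using rv_entropy_comp_le[OF sTG[of 0], of "\<lambda>u. (\<lambda>_. undefined, u)"]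
      by (simp add: TF_def[of 0])
  next
    case (Suc n)
    have 1: "rv_entropy M (\<lambda>x. (TF (Suc n) x, TG (Suc n) x)) \<le>
        rv_entropy M (\<lambda>x. ((TF n x, TG n x), F n x, G n x))"
      using rv_entropy_comp_le[of "\<lambda>x. ((TF n x, TG n x), F n x, G n x)"
          "\<lambda>((a, b), c, d). (a(n := c), b(n := d))"]
      by (simp add: TF_Suc TG_Suc simple_function_Pair sTF sTG F G)
    \<comment> \<open>Conditioning on the earlier entries as well does not raise the conditional
      entropy of \<open>F n\<close> given \<open>G n\<close>.\<close>
    have 2: "rv_entropy M (\<lambda>x. ((TF n x, TG n x), F n x, G n x)) + rv_entropy M (G n) \<le>
        rv_entropy M (\<lambda>x. ((TF n x, TG n x), G n x)) + rv_entropy M (\<lambda>x. (F n x, G n x))"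
      by (intro rv_entropy_submodular simple_function_Pair sTF sTG F G)
    \<comment> \<open>Likewise, knowing \<open>TF n\<close> besides \<open>TG n\<close> does not
      raise the conditional entropy of \<open>G n\<close>.\<close>
    have 3: "rv_entropy M (\<lambda>x. (TF n x, G n x, TG n x)) + rv_entropy M (TG n) \<le>
        rv_entropy M (\<lambda>x. (TF n x, TG n x)) + rv_entropy M (\<lambda>x. (G n x, TG n x))"
      by (intro rv_entropy_submodular sTF sTG G)
    have 4: "rv_entropy M (\<lambda>x. ((TF n x, TG n x), G n x)) \<le> rv_entropy M (\<lambda>x. (TF n x, G n x, TG n x))"
      using rv_entropy_comp_le[of "\<lambda>x. (TF n x, G n x, TG n x)" "\<lambda>(a, c, b). ((a, b), c)"]
      by (simp add: simple_function_Pair sTF sTG G)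
    have 5: "rv_entropy M (\<lambda>x. (G n x, TG n x)) \<le> rv_entropy M (TG (Suc n))"
      using rv_entropy_comp_le[OF sTG[of "Suc n"], of "\<lambda>u. (u n, restrict u {..<n})"]
      by (simp only: TG_proj[symmetric])
    show ?case
      using 1 2 3 4 5 Suc by simp
  qed
  moreover have "rv_entropy M (TF n) \<le> rv_entropy M (\<lambda>x. (TF n x, TG n x))"
    using rv_entropy_comp_le[of "\<lambda>x. (TF n x, TG n x)" fst] by (simp add: simple_function_Pair sTF sTG)
  ultimately show ?thesis
    unfolding TF_def[abs_def] TG_def[abs_def] by linarith
qed

text \<open>
  A Fano-type bound: \<open>c\<close> guesses \<open>X\<close> from \<open>Y\<close>. Compare the conditional law of \<open>X\<close> given \<open>Y = y\<close> with
  the (unnormalised) weights \<open>1\<close> at \<open>c y\<close> and \<open>t\<close> elsewhere, using \<open>ln u \<le> u - 1\<close>.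
\<close>

lemma rv_entropy_Pair_le:
  assumes X: "simple_function M X" and Y: "simple_function M Y"
    and N: "card (X ` space M) \<le> N" and t: "0 < t" "t \<le> 1"
    and e: "prob {x \<in> space M. X x \<noteq> c (Y x)} \<le> e"
  shows "rv_entropy M (\<lambda>x. (X x, Y x)) - rv_entropy M Y \<le> e * ln (1 / t) + real N * t"
proof -
  define W where "W = (\<lambda>x. (X x, Y x))"
  have W: "simple_function M W"
    unfolding W_def by (intro simple_function_Pair X Y)
  define p where "p v = prob (W -` {v} \<inter> space M)" for v
  define r where "r y = prob (Y -` {y} \<inter> space M)" for y
  define q where "q v = (if fst v = c (snd v) then 1 else t)" for v
  have q_pos [simp]: "0 < q v" for v
    using t by (simp add: q_def)
  have p_nn [simp]: "0 \<le> p v" and r_nn [simp]: "0 \<le> r y" for v y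
    by (auto simp: p_def r_def)
  have fin [simp]: "finite (W ` space M)" "finite (X ` space M)" "finite (Y ` space M)"
    using simple_functionD(1) X Y W by blast+
  have p_le: "p v \<le> r (snd v)" for v
    using prob_fibre_comp_mono[OF W, of v snd] by (simp add: p_def r_def W_def)
  \<comment> \<open>This is \<open>ln u \<le> u - 1\<close> for
    \<open>u = r (snd v) * q v / p v\<close>, multiplied by \<open>p v\<close>.\<close>
  have pointwise: "- p v * ln (p v) + p v * ln (r (snd v)) \<le> p v * ln (1 / q v) + r (snd v) * q v - p v" for v
  proof (cases "p v = 0")
    case True
    then show ?thesis by (simp add: less_imp_le)
  next
    case False
    then have pos: "0 < p v"
      using p_nn[of v] by linarith
    with p_le[of v] have "0 < r (snd v)"
      by linarith
    have "ln (r (snd v) * q v / p v) \<le> r (snd v) * q v / p v - 1"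
      using pos \<open>0 < r (snd v)\<close> by (intro ln_le_minus_one) simp
    from mult_left_mono[OF this p_nn[of v]]
    have "p v * ln (r (snd v) * q v / p v) \<le> r (snd v) * q v - p v"
      using pos by (simp add: algebra_simps)
    moreover have "ln (r (snd v) * q v / p v) = ln (r (snd v)) - ln (1 / q v) - ln (p v)"
      using pos \<open>0 < r (snd v)\<close> less_imp_neq[OF q_pos, of v, symmetric] by (simp add: ln_mult ln_div)
    ultimately have "p v * (ln (r (snd v)) - ln (1 / q v) - ln (p v)) \<le> r (snd v) * q v - p v"
      by simp
    then show ?thesis
      by (simp add: right_diff_distrib)
  qed
  have sum_p: "(\<Sum>v\<in>W ` space M. p v) = 1"
    unfolding p_def by (rule sum_prob_fibres[OF W])
  have sum_r: "(\<Sum>y\<in>Y ` space M. r y) = 1"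
    unfolding r_def by (rule sum_prob_fibres[OF Y])
  have "rv_entropy M W - rv_entropy M Y = (\<Sum>v\<in>W ` space M. - p v * ln (p v) + p v * ln (r (snd v)))"
    using rv_entropy_comp[OF W, of snd]
    unfolding rv_entropy_def[of M W] p_def r_def
    by (simp add: W_def sum.distrib sum_negf sum_subtractf)
  also have "\<dots> \<le> (\<Sum>v\<in>W ` space M. p v * ln (1 / q v) + r (snd v) * q v - p v)"
    by (intro sum_mono pointwise)
  also have "\<dots> = (\<Sum>v\<in>W ` space M. p v * ln (1 / q v)) + (\<Sum>v\<in>W ` space M. r (snd v) * q v) - 1"
    by (simp add: sum.distrib sum_subtractf sum_p)
  \<comment> \<open>\<open>ln (1 / q v)\<close> is \<open>0\<close> on correct guesses and
    \<open>ln (1 / t)\<close> on wrong ones, so only the truth value of the error matters.\<close>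
  also have "(\<Sum>v\<in>W ` space M. p v * ln (1 / q v)) =
      (\<Sum>w\<in>(\<lambda>x. X x \<noteq> c (Y x)) ` space M.
        prob ((\<lambda>x. X x \<noteq> c (Y x)) -` {w} \<inter> space M) * (if w then ln (1 / t) else 0))"
    using sum_prob_fibres_comp[OF W, of "\<lambda>w. if w then ln (1 / t) else 0" "\<lambda>v. fst v \<noteq> c (snd v)"]
    unfolding p_def[symmetric]
    by (auto simp: W_def q_def intro!: sum.cong elim!: trans[rotated])
  also have "\<dots> \<le> (\<Sum>w\<in>UNIV.
        prob ((\<lambda>x. X x \<noteq> c (Y x)) -` {w} \<inter> space M) * (if w then ln (1 / t) else 0))"
    using t by (intro sum_mono2) auto
  also have "\<dots> = prob {x \<in> space M. X x \<noteq> c (Y x)} * ln (1 / t)"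
    by (simp add: UNIV_bool vimage_def Int_def conj_commute)
  also have "\<dots> \<le> e * ln (1 / t)"
    using t e by (intro mult_right_mono) auto
  \<comment> \<open>Over the full product of values, the weights for a fixed \<open>y\<close> add up
    to at most \<open>1 + N * t\<close>, as at most one value is the guess
    \<open>c y\<close>.\<close>
  also have "(\<Sum>v\<in>W ` space M. r (snd v) * q v) \<le>
      (\<Sum>v\<in>X ` space M \<times> Y ` space M. r (snd v) * q v)"
    by (intro sum_mono2) (auto simp: W_def less_imp_le)
  also have "\<dots> = (\<Sum>y\<in>Y ` space M. r y * (\<Sum>x\<in>X ` space M. q (x, y)))"
    unfolding sum_distrib_left by (subst sum.swap) (simp add: sum.cartesian_product case_prod_unfold)
  also have "\<dots> \<le> (\<Sum>y\<in>Y ` space M. r y * (1 + real N * t))"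
  proof (intro sum_mono mult_left_mono r_nn)
    fix y
    have "(\<Sum>x\<in>X ` space M. q (x, y)) \<le> (\<Sum>x\<in>X ` space M. (if c y = x then 1 else 0) + t)"
      using t by (intro sum_mono) (auto simp: q_def)
    also have "\<dots> \<le> 1 + real (card (X ` space M)) * t"
      by (simp add: sum.distrib)
    also have "\<dots> \<le> 1 + real N * t"
      using N t by (simp add: mult_right_mono)
    finally show "(\<Sum>x\<in>X ` space M. q (x, y)) \<le> 1 + real N * t" .
  qed
  also have "\<dots> = 1 + real N * t"
    by (simp add: sum_r flip: sum_distrib_right)
  finally show ?thesis
    by (simp add: W_def)
qed

end

section \<open>Partitions and their labelling maps\<close>

text \<open>The labelling map of a partition: each member serves as its own label. It is meaningful
  at points that the partition covers.\<close>

definition cell :: "'a set set \<Rightarrow> 'a \<Rightarrow> 'a set" where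
  "cell P x = (THE A. A \<in> P \<and> x \<in> A)"

lemma cell_eq:
  assumes "partition_on S P" "A \<in> P" "x \<in> A"
  shows "cell P x = A"
  unfolding cell_def using assms by (intro the_equality) (auto simp: partition_on_def disjoint_def)

lemma cell_in_partition:
  assumes "partition_on S P" "x \<in> S"
  shows "cell P x \<in> P" "x \<in> cell P x"
proof -
  obtain A where "A \<in> P" "x \<in> A"
    using assms by (auto simp: partition_on_def)
  with cell_eq[OF assms(1) this] show "cell P x \<in> P" "x \<in> cell P x"
    by auto
qed

lemma cell_eq_iff:
  assumes "partition_on S P" "A \<in> P" "x \<in> S"
  shows "cell P x = A \<longleftrightarrow> x \<in> A"
  using assms cell_eq cell_in_partition by metis

text \<open>Members of a common refinement are nonempty, and any point of one forces which member of
  each partition was intersected.\<close>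

lemma common_refinement_eq_cells:
  assumes "\<P> \<noteq> {}" and part: "\<And>P. P \<in> \<P> \<Longrightarrow> partition_on S P"
  shows "common_refinement \<P> = (\<lambda>x. \<Inter>P\<in>\<P>. cell P x) ` S"
proof (intro equalityI subsetI)
  fix C assume "C \<in> common_refinement \<P>"
  then obtain g x where g: "g \<in> (\<Pi> P\<in>\<P>. P)" "C = \<Inter> (g ` \<P>)" and x: "x \<in> C"
    by (auto simp: common_refinement)
  have "x \<in> S"
    using assms g x by (fastforce simp: partition_on_def Pi_iff)
  moreover have "cell P x = g P" if "P \<in> \<P>" for P
    using that g x part by (intro cell_eq) auto
  ultimately show "C \<in> (\<lambda>x. \<Inter>P\<in>\<P>. cell P x) ` S"
    using g by auto
next
  fix C assume "C \<in> (\<lambda>x. \<Inter>P\<in>\<P>. cell P x) ` S"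
  then obtain x where x: "x \<in> S" "C = (\<Inter>P\<in>\<P>. cell P x)"
    by auto
  then have "(\<lambda>P. cell P x) \<in> (\<Pi> P\<in>\<P>. P)" "x \<in> C"
    using part cell_in_partition by fastforce+
  then show "C \<in> common_refinement \<P>"
    unfolding common_refinement using x by blast
qed

lemma partition_on_pullback:
  assumes "partition_on T P" "g \<in> S \<rightarrow> T"
  shows "partition_on S (pullback_partition S g P)"
proof (rule partition_onI)
  have "\<Union>P = T" and disj: "\<And>A B. A \<in> P \<Longrightarrow> B \<in> P \<Longrightarrow> A \<noteq> B \<Longrightarrow> A \<inter> B = {}"
    using assms(1) by (auto simp: partition_on_def disjoint_def)
  with assms(2) show "\<Union>(pullback_partition S g P) = S"
    unfolding pullback_partition_def by blast
  fix A B assume "A \<in> pullback_partition S g P" "B \<in> pullback_partition S g P" "A \<noteq> B"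
  then obtain A' B' where "A' \<in> P" "B' \<in> P" "A' \<noteq> B'" "A = g -` A' \<inter> S" "B = g -` B' \<inter> S"
    unfolding pullback_partition_def by blast
  with disj[of A' B'] show "disjnt A B"
    by (auto simp: disjnt_def)
qed (simp add: pullback_partition_def)

lemma cell_pullback:
  assumes "partition_on T P" "g \<in> S \<rightarrow> T" "x \<in> S"
  shows "cell (pullback_partition S g P) x = g -` cell P (g x) \<inter> S"
proof (rule cell_eq[OF partition_on_pullback[OF assms(1,2)]])
  have "g x \<in> T"
    using assms by auto
  from cell_in_partition[OF assms(1) this] assms(3)
  show "x \<in> g -` cell P (g x) \<inter> S" "g -` cell P (g x) \<inter> S \<in> pullback_partition S g P"
    unfolding pullback_partition_def by auto
qed

lemma nds_iter_funcset:
  assumes "\<And>n. f n \<in> mspace (X n) \<rightarrow> mspace (X (Suc n))"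
  shows "nds_iter f 0 n \<in> mspace (X 0) \<rightarrow> mspace (X n)"
  using assms by (induction n) (auto simp: Pi_iff)

text \<open>Two points lie in the same member of the join iff their orbits visit the same cells
  before time \<open>n\<close>, that is, iff their itineraries \<open>L\<close> agree. Positivity of
  \<open>n\<close> avoids an empty intersection.\<close>

lemma joined_partition_eq_fibres:
  assumes P: "\<And>i. partition_on (mspace (X i)) (P i)"
    and f: "\<And>n. f n \<in> mspace (X n) \<rightarrow> mspace (X (Suc n))"
    and n: "0 < n"
  defines "L \<equiv> \<lambda>x. restrict (\<lambda>i. cell (P i) (nds_iter f 0 i x)) {..<n}"
  shows "joined_partition X f P n = (\<lambda>v. L -` {v} \<inter> mspace (X 0)) ` L ` mspace (X 0)"
proof -
  let ?S = "mspace (X 0)"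
  have it: "nds_iter f 0 i \<in> ?S \<rightarrow> mspace (X i)" for i
    using f by (rule nds_iter_funcset)
  have "joined_partition X f P n =
      (\<lambda>x. \<Inter>i<n. cell (pullback_partition ?S (nds_iter f 0 i) (P i)) x) ` ?S"
    unfolding joined_partition_def using n partition_on_pullback[OF P it]
    by (subst common_refinement_eq_cells[where S = ?S]) (auto simp: image_image)
  also have "\<dots> = (\<lambda>x. L -` {L x} \<inter> ?S) ` ?S"
  proof (intro image_cong refl)
    fix x assume x: "x \<in> ?S"
    have "(\<Inter>i<n. cell (pullback_partition ?S (nds_iter f 0 i) (P i)) x) =
        (\<Inter>i<n. nds_iter f 0 i -` cell (P i) (nds_iter f 0 i x) \<inter> ?S)"
      using cell_pullback[OF P it x] by simp
    also have "\<dots> = {y \<in> ?S. \<forall>i<n. nds_iter f 0 i y \<in> cell (P i) (nds_iter f 0 i x)}"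
      using n by auto
    also have "\<dots> = {y \<in> ?S. \<forall>i<n. cell (P i) (nds_iter f 0 i y) = cell (P i) (nds_iter f 0 i x)}"
    proof (intro Collect_cong conj_cong refl all_cong1 imp_cong)
      fix y i assume "y \<in> ?S"
      with it x show "nds_iter f 0 i y \<in> cell (P i) (nds_iter f 0 i x) \<longleftrightarrow>
          cell (P i) (nds_iter f 0 i y) = cell (P i) (nds_iter f 0 i x)"
        by (subst cell_eq_iff[OF P cell_in_partition(1)[OF P]]) auto
    qed
    also have "\<dots> = L -` {L x} \<inter> ?S"
    proof -
      have "L y = L x \<longleftrightarrow> (\<forall>i<n. cell (P i) (nds_iter f 0 i y) = cell (P i) (nds_iter f 0 i x))" for y
        unfolding L_def restrict_def fun_eq_iff by auto
      then show ?thesis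
        by auto
    qed
    finally show "(\<Inter>i<n. cell (pullback_partition ?S (nds_iter f 0 i) (P i)) x) = L -` {L x} \<inter> ?S" .
  qed
  finally show ?thesis
    by (simp add: image_image)
qed

section \<open>Nonautonomous systems with an invariant measure sequence\<close>

lemma space_borel_of_metric [simp]: "space (borel_of_metric m) = mspace m"
  by (simp add: borel_of_metric_def space_measure_of_conv)

lemma sets_borel_of_metric:
  "sets (borel_of_metric m) = sigma_sets (mspace m) {U. openin (mtopology_of m) U}"
  unfolding borel_of_metric_def
  using openin_subset[of "mtopology_of m"] by (intro sets_measure_of) auto

lemma continuous_map_measurable_borel_of_metric:
  assumes "continuous_map (mtopology_of m) (mtopology_of m') g"
  shows "g \<in> borel_of_metric m \<rightarrow>\<^sub>M borel_of_metric m'"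
proof (rule measurable_sigma_sets[OF sets_borel_of_metric])
  show "g \<in> space (borel_of_metric m) \<rightarrow> mspace m'"
    using assms by (auto simp: continuous_map_def)
  fix U assume "U \<in> {U. openin (mtopology_of m') U}"
  then have "openin (mtopology_of m) {x \<in> mspace m. g x \<in> U}"
    using assms by (auto simp: continuous_map_def)
  moreover have "{x \<in> mspace m. g x \<in> U} = g -` U \<inter> space (borel_of_metric m)"
    by auto
  ultimately show "g -` U \<inter> space (borel_of_metric m) \<in> sets (borel_of_metric m)"
    by (auto simp: sets_borel_of_metric)
qed (use openin_subset[of "mtopology_of m'"] in auto)

text \<open>Metric spaces are Hausdorff, so compact sets are closed. This makes the sets
  \<open>K n A\<close> of an admissible sequence measurable.\<close>

lemma compactin_sets_borel_of_metric:
  assumes "compactin (mtopology_of m) K"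
  shows "K \<in> sets (borel_of_metric m)"
proof -
  have "closedin (mtopology_of m) K"
    using assms Metric_space.Hausdorff_space_mtopology[OF Metric_space_mspace_mdist]
    by (intro compactin_imp_closedin) (auto simp: mtopology_of_def)
  then have "mspace m - K \<in> sets (borel_of_metric m)" "K \<subseteq> mspace m"
    by (auto simp: closedin_def sets_borel_of_metric)
  then show ?thesis
    by (metis sets.compl_sets space_borel_of_metric double_diff subset_refl)
qed

lemma equicontinuous_seq_continuous_map:
  assumes "equicontinuous_seq X f" "f n \<in> mspace (X n) \<rightarrow> mspace (X (Suc n))"
  shows "continuous_map (mtopology_of (X n)) (mtopology_of (X (Suc n))) (f n)"
  using assms
  by (intro uniformly_continuous_imp_continuous_map)
    (fastforce simp: uniformly_continuous_map_def equicontinuous_seq_def)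

section \<open>Transport of measures and partitions along orbits\<close>

locale measured_NDS =
  fixes X :: "nat \<Rightarrow> 'a metric" and f :: "nat \<Rightarrow> 'a \<Rightarrow> 'a" and \<mu> :: "nat \<Rightarrow> 'a measure"
  assumes NDS: "topological_NDS X f" and IMS: "invariant_measure_seq X f \<mu>"
begin

abbreviation orbit :: "nat \<Rightarrow> 'a \<Rightarrow> 'a" where
  "orbit \<equiv> nds_iter f 0"

lemma f_funcset: "f n \<in> mspace (X n) \<rightarrow> mspace (X (Suc n))"
  using NDS by (simp add: topological_NDS_def)

lemma prob_space_\<mu>: "prob_space (\<mu> n)"
  and space_\<mu> [simp]: "space (\<mu> n) = mspace (X n)"
  and sets_\<mu>: "sets (\<mu> n) = sets (borel_of_metric (X n))"
  and distr_f: "distr (\<mu> n) (\<mu> (Suc n)) (f n) = \<mu> (Suc n)"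
  using IMS by (auto simp: invariant_measure_seq_def)

lemma measurable_f: "f n \<in> \<mu> n \<rightarrow>\<^sub>M \<mu> (Suc n)"
  using continuous_map_measurable_borel_of_metric[OF equicontinuous_seq_continuous_map[where X = X and f = f and n = n, OF _ f_funcset]] NDS
  by (simp add: topological_NDS_def measurable_cong_sets[OF sets_\<mu> sets_\<mu>])

lemma measurable_orbit: "orbit n \<in> \<mu> 0 \<rightarrow>\<^sub>M \<mu> n"
proof (induction n)
  case (Suc n)
  then show ?case
    using measurable_comp[OF Suc measurable_f] by (simp only: nds_iter.simps add_0)
qed (simp add: id_def)

lemma distr_orbit: "distr (\<mu> 0) (\<mu> n) (orbit n) = \<mu> n"
proof (induction n)
  case (Suc n)
  have "distr (\<mu> 0) (\<mu> (Suc n)) (orbit (Suc n)) = distr (distr (\<mu> 0) (\<mu> n) (orbit n)) (\<mu> (Suc n)) (f n)"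
    using distr_distr[OF measurable_f measurable_orbit] by simp
  then show ?case
    using Suc distr_f by (simp only:)
qed (simp add: distr_id2 id_def)

text \<open>Invariance iterated \<open>n\<close> times; it moves estimates in \<open>X n\<close>
  back to \<open>X 0\<close>, where all the entropies live.\<close>

lemma measure_orbit_vimage:
  assumes "A \<in> sets (\<mu> n)"
  shows "measure (\<mu> 0) (orbit n -` A \<inter> mspace (X 0)) = measure (\<mu> n) A"
  using measure_distr[OF measurable_orbit assms] by (simp add: distr_orbit)

lemma finite_borel_partitionD:
  assumes "finite_borel_partition (X n) P"
  shows "finite P" "partition_on (mspace (X n)) P" "A \<in> P \<Longrightarrow> A \<in> sets (\<mu> n)"
  using assms by (auto simp: finite_borel_partition_def sets_\<mu>)

lemma orbit_in: "x \<in> mspace (X 0) \<Longrightarrow> orbit n x \<in> mspace (X n)"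
  using nds_iter_funcset[of f X n] f_funcset by auto

lemma
  assumes P: "finite_borel_partition (X n) P"
  shows simple_function_cell_orbit: "simple_function (\<mu> 0) (\<lambda>x. cell P (orbit n x))"
    and card_cell_orbit_le: "card ((\<lambda>x. cell P (orbit n x)) ` mspace (X 0)) \<le> card P"
proof -
  note P' = finite_borel_partitionD[OF P]
  have sub: "(\<lambda>x. cell P (orbit n x)) ` mspace (X 0) \<subseteq> P"
    using cell_in_partition(1)[OF P'(2)] orbit_in by auto
  then show "card ((\<lambda>x. cell P (orbit n x)) ` mspace (X 0)) \<le> card P"
    using P'(1) by (intro card_mono)
  have "(\<lambda>x. cell P (orbit n x)) -` {A} \<inter> space (\<mu> 0) \<in> sets (\<mu> 0)" if "A \<in> P" for A
  proof -
    have "(\<lambda>x. cell P (orbit n x)) -` {A} \<inter> space (\<mu> 0) = orbit n -` A \<inter> space (\<mu> 0)"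
      using cell_eq_iff[OF P'(2) that] orbit_in by auto
    then show ?thesis
      using measurable_sets[OF measurable_orbit P'(3)[OF that]] by (simp only:)
  qed
  then show "simple_function (\<mu> 0) (\<lambda>x. cell P (orbit n x))"
    unfolding simple_function_def using sub finite_subset[OF sub P'(1)] by auto
qed

lemma partition_entropy_joined:
  assumes "\<And>n. finite_borel_partition (X n) (P n)" "0 < n"
  shows "partition_entropy (\<mu> 0) (joined_partition X f P n) =
    rv_entropy (\<mu> 0) (\<lambda>x. restrict (\<lambda>i. cell (P i) (orbit i x)) {..<n})"
  using joined_partition_eq_fibres[where X = X and P = P and f = f, OF _ f_funcset assms(2)]
    finite_borel_partitionD(2)[OF assms(1)] partition_entropy_fibres[of "\<mu> 0"]
  by (simp add: space_\<mu>)

text \<open>Apply the Fano-type bound: a member \<open>C\<close> of \<open>R\<close> meets at most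
  one \<open>K A\<close>, and guessing that \<open>A\<close> fails only if the orbit point lies in
  some \<open>A - K A\<close>, an event of probability at most \<open>N * \<eta>\<close>.\<close>

lemma conditional_entropy_orbit_le:
  assumes P: "finite_borel_partition (X n) P" and R: "finite_borel_partition (X n) R"
    and N: "card P \<le> N" and t: "0 < t" "t \<le> 1"
    and K: "\<And>A. A \<in> P \<Longrightarrow> K A \<subseteq> A" "\<And>A. A \<in> P \<Longrightarrow> K A \<in> sets (\<mu> n)"
      "\<And>A. A \<in> P \<Longrightarrow> measure (\<mu> n) (A - K A) \<le> \<eta>"
    and sep: "\<And>A B C. A \<in> P \<Longrightarrow> B \<in> P \<Longrightarrow> C \<in> R \<Longrightarrow> C \<inter> K A \<noteq> {} \<Longrightarrow> C \<inter> K B \<noteq> {} \<Longrightarrow> A = B"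
  shows "rv_entropy (\<mu> 0) (\<lambda>x. (cell P (orbit n x), cell R (orbit n x)))
      - rv_entropy (\<mu> 0) (\<lambda>x. cell R (orbit n x)) \<le> real N * \<eta> * ln (1 / t) + real N * t"
proof -
  interpret prob_space "\<mu> 0"
    by (rule prob_space_\<mu>)
  note P' = finite_borel_partitionD[OF P] and R' = finite_borel_partitionD[OF R]
  \<comment> \<open>If \<open>C\<close> meets no \<open>K A\<close>, the guess is arbitrary; all
    points of such a \<open>C\<close> lie outside the sets \<open>K A\<close> and are covered by the
    error event.\<close>
  define c where "c C = (SOME A. A \<in> P \<and> C \<inter> K A \<noteq> {})" for C
  have c: "c C = A" if "A \<in> P" "C \<in> R" "C \<inter> K A \<noteq> {}" for A C
    unfolding c_def using that sep by (intro some_equality) auto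
  let ?E = "{x \<in> space (\<mu> 0). cell P (orbit n x) \<noteq> c (cell R (orbit n x))}"
  have E: "?E \<subseteq> (\<Union>A\<in>P. orbit n -` (A - K A) \<inter> mspace (X 0))"
  proof
    fix x assume x: "x \<in> ?E"
    then have "orbit n x \<in> mspace (X n)"
      by (simp add: orbit_in)
    then show "x \<in> (\<Union>A\<in>P. orbit n -` (A - K A) \<inter> mspace (X 0))"
      using x c[of "cell P (orbit n x)" "cell R (orbit n x)"]
        cell_in_partition[OF P'(2), of "orbit n x"] cell_in_partition[OF R'(2), of "orbit n x"] by fastforce
  qed
  have m: "orbit n -` (A - K A) \<inter> mspace (X 0) \<in> events" if "A \<in> P" for A
    using measurable_sets[OF measurable_orbit, of "A - K A" n] P'(3) K that by auto
  have "prob ?E \<le> prob (\<Union>A\<in>P. orbit n -` (A - K A) \<inter> mspace (X 0))"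
    using m P'(1) by (intro finite_measure_mono E sets.finite_UN)
  also have "\<dots> \<le> (\<Sum>A\<in>P. prob (orbit n -` (A - K A) \<inter> mspace (X 0)))"
    using m P'(1) by (intro finite_measure_subadditive_finite) auto
  also have "\<dots> \<le> (\<Sum>A\<in>P. \<eta>)"
    using P'(3) K by (intro sum_mono) (simp add: measure_orbit_vimage)
  also have "\<dots> \<le> real N * \<eta>"
  \<comment> \<open>Passing from \<open>card P\<close> to \<open>N\<close> needs
    \<open>0 \<le> \<eta>\<close>, which any member of \<open>P\<close> supplies; one exists since
    \<open>X n\<close> is nonempty.\<close>
  proof (cases "P = {}")
    case False
    then obtain A where "A \<in> P" by auto
    then have "0 \<le> \<eta>"
      using K(3) measure_nonneg order_trans by blast
    then show ?thesis
      using N by (simp add: mult_right_mono)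
  next
    case True
    have "mspace (X n) \<noteq> {}"
      using NDS by (simp add: topological_NDS_def)
    then show ?thesis
      using True P'(2) by (auto simp: partition_on_def)
  qed
  finally show ?thesis
    using card_cell_orbit_le[OF P] N t
    by (intro rv_entropy_Pair_le simple_function_cell_orbit P R) auto
qed

section \<open>Comparing the entropies of two partition sequences\<close>

lemma mdist_le_diam_seq:
  assumes "A \<in> Q n" "x \<in> A" "y \<in> A"
  shows "ereal (mdist (X n) x y) \<le> diam_seq X Q"
proof -
  have "ereal (mdist (X n) x y) \<le> metric_diam (X n) A"
    unfolding metric_diam_def by (rule SUP_upper2[of "(x, y)"]) (use assms in simp_all)
  also have "\<dots> \<le> diam_seq X Q"
    unfolding diam_seq_def by (rule SUP_upper2[of n], simp, rule SUP_upper, fact)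
  finally show ?thesis .
qed

lemma entropy_wrt_le_add:
  assumes P: "\<And>n. finite_borel_partition (X n) (P n)" and Q: "\<And>n. finite_borel_partition (X n) (Q n)"
    and e: "0 \<le> e"
    and le: "\<And>n. rv_entropy (\<mu> 0) (\<lambda>x. (cell (P n) (orbit n x), cell (Q n) (orbit n x)))
      - rv_entropy (\<mu> 0) (\<lambda>x. cell (Q n) (orbit n x)) \<le> e"
  shows "entropy_wrt X f \<mu> P \<le> entropy_wrt X f \<mu> Q + ereal e"
proof -
  interpret prob_space "\<mu> 0"
    by (rule prob_space_\<mu>)
  let ?H = "\<lambda>P n. 1 / real n * partition_entropy (\<mu> 0) (joined_partition X f P n)"
  \<comment> \<open>At \<open>n = 0\<close> the factor \<open>1 / real 0\<close> is
    \<open>0\<close>, so the claim reads \<open>0 \<le> e\<close>. For other \<open>n\<close>, the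
    error \<open>n * e\<close> of the tuple bound is divided by \<open>n\<close>.\<close>
  have "?H P n \<le> ?H Q n + e" for n
  proof (cases "n = 0")
    case False
    let ?F = "\<lambda>i x. cell (P i) (orbit i x)" and ?G = "\<lambda>i x. cell (Q i) (orbit i x)"
    have "rv_entropy (\<mu> 0) (\<lambda>x. restrict (\<lambda>i. ?F i x) {..<n}) \<le>
        rv_entropy (\<mu> 0) (\<lambda>x. restrict (\<lambda>i. ?G i x) {..<n}) +
        (\<Sum>i<n. rv_entropy (\<mu> 0) (\<lambda>x. (?F i x, ?G i x)) - rv_entropy (\<mu> 0) (?G i))"
      by (intro rv_entropy_tuple_le simple_function_cell_orbit P Q)
    also have "(\<Sum>i<n. rv_entropy (\<mu> 0) (\<lambda>x. (?F i x, ?G i x)) - rv_entropy (\<mu> 0) (?G i)) \<le> real n * e"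
      using sum_mono[of "{..<n}", OF le] by simp
    finally show ?thesis
      using False
      by (simp add: partition_entropy_joined[OF P] partition_entropy_joined[OF Q] field_simps del: restrict_apply)
  qed (use e in simp)
  then have "entropy_wrt X f \<mu> P \<le> limsup (\<lambda>n. ereal (?H Q n) + ereal e)"
    unfolding entropy_wrt_def by (intro Limsup_mono always_eventually) simp
  also have "\<dots> = entropy_wrt X f \<mu> Q + ereal e"
    unfolding entropy_wrt_def by (rule Limsup_add_ereal_right) auto
  finally show ?thesis .
qed

lemma admissible_seqsD:
  assumes "P \<in> admissible_seqs X \<mu>"
  shows "finite_borel_partition (X n) (P n)" "\<exists>N. \<forall>n. card (P n) \<le> N"
  using assms by (simp_all add: admissible_seqs_def)

lemma admissible_seqs_separation:
  assumes "P \<in> admissible_seqs X \<mu>" "0 < \<epsilon>"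
  obtains \<delta> K where "0 < \<delta>" "\<And>n A. A \<in> P n \<Longrightarrow> K n A \<subseteq> A"
    "\<And>n A. A \<in> P n \<Longrightarrow> compactin (mtopology_of (X n)) (K n A)"
    "\<And>n A. A \<in> P n \<Longrightarrow> measure (\<mu> n) (A - K n A) \<le> \<epsilon>"
    "\<And>n A B x y. A \<in> P n \<Longrightarrow> B \<in> P n \<Longrightarrow> A \<noteq> B \<Longrightarrow> x \<in> K n A \<Longrightarrow> y \<in> K n B \<Longrightarrow>
      \<delta> \<le> mdist (X n) x y"
proof -
  from assms(1) have "\<forall>\<epsilon>>0. \<exists>\<delta>>0. \<exists>K :: nat \<Rightarrow> 'a set \<Rightarrow> 'a set. \<forall>n.
      (\<forall>A\<in>P n. K n A \<subseteq> A \<and> compactin (mtopology_of (X n)) (K n A) \<and> measure (\<mu> n) (A - K n A) \<le> \<epsilon>) \<and>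
      (\<forall>A\<in>P n. \<forall>B\<in>P n. A \<noteq> B \<longrightarrow> (\<forall>x\<in>K n A. \<forall>y\<in>K n B. mdist (X n) x y \<ge> \<delta>))"
    unfolding admissible_seqs_def mem_Collect_eq by (elim conjE)
  from this[THEN spec, THEN mp, OF assms(2)] obtain \<delta> K where "0 < \<delta>" and *: "\<And>n.
      (\<forall>A\<in>P n. K n A \<subseteq> A \<and> compactin (mtopology_of (X n)) (K n A) \<and> measure (\<mu> n) (A - K n A) \<le> \<epsilon>) \<and>
      (\<forall>A\<in>P n. \<forall>B\<in>P n. A \<noteq> B \<longrightarrow> (\<forall>x\<in>K n A. \<forall>y\<in>K n B. mdist (X n) x y \<ge> \<delta>))"
    by (elim exE conjE) (rule that, assumption, erule spec)
  note conjunct1[OF *, THEN bspec] conjunct2[OF *, THEN bspec, THEN bspec, THEN mp, THEN bspec, THEN bspec]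
  then show ?thesis
    by (intro that[OF \<open>0 < \<delta>\<close>, of K]) simp_all
qed

text \<open>The constants are chosen in the order \<open>N\<close>, \<open>t\<close>,
  \<open>\<eta>\<close>, \<open>\<delta>\<close>, and only then \<open>k\<close>: first
  \<open>t\<close> makes \<open>N * t\<close> small, then \<open>\<eta>\<close> makes the term with
  \<open>ln (1 / t)\<close> small, and admissibility turns \<open>\<eta>\<close> into
  \<open>\<delta>\<close>.\<close>

lemma eventually_entropy_wrt_le_add:
  assumes R: "\<And>k. R k \<in> admissible_seqs X \<mu>" and lim: "(\<lambda>k. diam_seq X (R k)) \<longlonglongrightarrow> 0"
    and P: "P \<in> admissible_seqs X \<mu>" and e: "0 < e"
  shows "eventually (\<lambda>k. entropy_wrt X f \<mu> P \<le> entropy_wrt X f \<mu> (R k) + ereal e) sequentially"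
proof -
  obtain N where N: "\<And>n. card (P n) \<le> N"
    using admissible_seqsD(2)[OF P] by blast
  \<comment> \<open>\<open>N + 1\<close> keeps the denominator nonzero, and \<open>t \<le> 1\<close>
    gives \<open>ln (1 / t) \<ge> 0\<close>.\<close>
  define t where "t = min 1 (e / (2 * (real N + 1)))"
  have t: "0 < t" "t \<le> 1" "t \<le> e / (2 * (real N + 1))"
    using e by (auto simp: t_def)
  \<comment> \<open>The summand \<open>1\<close> guards against \<open>t = 1\<close>, where the
    logarithm vanishes.\<close>
  define \<eta> where "\<eta> = e / (2 * (real N + 1) * (ln (1 / t) + 1))"
  have l: "0 \<le> ln (1 / t)"
    using t by simp
  then have \<eta>: "0 < \<eta>"
    unfolding \<eta>_def using e by (intro divide_pos_pos mult_pos_pos) auto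
  have "real N * t \<le> (real N + 1) * (e / (2 * (real N + 1)))"
    using t by (intro mult_mono) auto
  also have "\<dots> = e / 2"
    by (simp add: divide_simps)
  finally have 1: "real N * t \<le> e / 2" .
  have "real N * \<eta> * ln (1 / t) \<le> (real N + 1) * \<eta> * (ln (1 / t) + 1)"
    using l \<eta> by (intro mult_mono) auto
  also have "\<dots> = e / 2"
  proof -
    have "ln (1 / t) + 1 \<noteq> 0"
      using l by linarith
    then show ?thesis
      unfolding \<eta>_def by (simp add: divide_simps del: ln_div)
  qed
  finally have 2: "real N * \<eta> * ln (1 / t) \<le> e / 2" .
  obtain \<delta> K where \<delta>: "0 < \<delta>"
    and K: "\<And>n A. A \<in> P n \<Longrightarrow> K n A \<subseteq> A" "\<And>n A. A \<in> P n \<Longrightarrow> compactin (mtopology_of (X n)) (K n A)"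
      "\<And>n A. A \<in> P n \<Longrightarrow> measure (\<mu> n) (A - K n A) \<le> \<eta>"
    and sep: "\<And>n A B x y. A \<in> P n \<Longrightarrow> B \<in> P n \<Longrightarrow> A \<noteq> B \<Longrightarrow> x \<in> K n A \<Longrightarrow> y \<in> K n B \<Longrightarrow>
        \<delta> \<le> mdist (X n) x y"
    by (rule admissible_seqs_separation[OF P \<eta>], rule that)
  have "eventually (\<lambda>k. diam_seq X (R k) < ereal \<delta>) sequentially"
    using \<delta> by (intro order_tendstoD[OF lim]) auto
  then show ?thesis
  proof eventually_elim
    case (elim k)
    show ?case
    proof (rule entropy_wrt_le_add[OF admissible_seqsD(1)[OF P] admissible_seqsD(1)[OF R]])
      fix n
      have "rv_entropy (\<mu> 0) (\<lambda>x. (cell (P n) (orbit n x), cell (R k n) (orbit n x)))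
          - rv_entropy (\<mu> 0) (\<lambda>x. cell (R k n) (orbit n x)) \<le> real N * \<eta> * ln (1 / t) + real N * t"
      proof (rule conditional_entropy_orbit_le[OF admissible_seqsD(1)[OF P] admissible_seqsD(1)[OF R] N t(1,2)])
        fix A assume "A \<in> P n"
        from K[OF this] show "K n A \<subseteq> A" "K n A \<in> sets (\<mu> n)" "measure (\<mu> n) (A - K n A) \<le> \<eta>"
          unfolding sets_\<mu> by (blast intro: compactin_sets_borel_of_metric)+
      next
        \<comment> \<open>Points of one member of \<open>R k n\<close> are closer than
          \<open>\<delta>\<close>, while different sets \<open>K n A\<close> and
          \<open>K n B\<close> are at least \<open>\<delta>\<close> apart.\<close>
        fix A B C assume AB: "A \<in> P n" "B \<in> P n" and C: "C \<in> R k n" "C \<inter> K n A \<noteq> {}" "C \<inter> K n B \<noteq> {}"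
        then obtain x y where xy: "x \<in> C" "x \<in> K n A" "y \<in> C" "y \<in> K n B"
          by blast
        have "ereal (mdist (X n) x y) < ereal \<delta>"
          using mdist_le_diam_seq[of C "R k" n, OF C(1) xy(1,3)] elim by (rule le_less_trans)
        then show "A = B"
          using sep[OF AB _ xy(2,4)] by (cases "A = B") simp_all
      qed
      also have "\<dots> \<le> e"
        using 1 2 by linarith
      finally show "rv_entropy (\<mu> 0) (\<lambda>x. (cell (P n) (orbit n x), cell (R k n) (orbit n x)))
          - rv_entropy (\<mu> 0) (\<lambda>x. cell (R k n) (orbit n x)) \<le> e" .
    qed (use e in simp)
  qed
qed

end

theorem theorem3p3:
  fixes X :: "nat \<Rightarrow> 'a metric" and f :: "nat \<Rightarrow> 'a \<Rightarrow> 'a"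
    and \<mu> :: "nat \<Rightarrow> 'a measure" and R :: "nat \<Rightarrow> nat \<Rightarrow> 'a set set"
  assumes "topological_NDS X f"
    and "invariant_measure_seq X f \<mu>"
    and "\<And>k. R k \<in> admissible_seqs X \<mu>"
    and "(\<lambda>k. diam_seq X (R k)) \<longlonglongrightarrow> 0"
  shows "metric_entropy X f \<mu> = (SUP k. entropy_wrt X f \<mu> (R k)) \<and>
         (\<lambda>k. entropy_wrt X f \<mu> (R k)) \<longlonglongrightarrow> metric_entropy X f \<mu>"
proof -
  interpret measured_NDS X f \<mu>
    using assms(1,2) by unfold_locales
  let ?h = "\<lambda>k. entropy_wrt X f \<mu> (R k)"
  have "metric_entropy X f \<mu> \<le> liminf ?h"
    unfolding metric_entropy_def
  proof (rule SUP_least)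
    fix P assume P: "P \<in> admissible_seqs X \<mu>"
    show "entropy_wrt X f \<mu> P \<le> liminf ?h"
    proof (rule ereal_le_epsilon2)
      fix e :: real assume "0 < e"
      then have "entropy_wrt X f \<mu> P \<le> liminf (\<lambda>k. ?h k + ereal e)"
        by (intro Liminf_bounded eventually_entropy_wrt_le_add assms P)
      also have "\<dots> = liminf ?h + ereal e"
        by (rule Liminf_add_ereal_right) auto
      finally show "entropy_wrt X f \<mu> P \<le> liminf ?h + ereal e" .
    qed
  qed
  moreover have "liminf ?h \<le> limsup ?h"
    by (rule Liminf_le_Limsup) simp
  moreover have "limsup ?h \<le> (SUP k. ?h k)"
    by (intro Limsup_bounded always_eventually allI SUP_upper UNIV_I)
  moreover have "(SUP k. ?h k) \<le> metric_entropy X f \<mu>"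
    unfolding metric_entropy_def using assms(3) by (intro SUP_least SUP_upper)
  \<comment> \<open>The inequalities form a cycle from \<open>metric_entropy\<close> through
    \<open>liminf\<close>, \<open>limsup\<close> and the supremum back to
    \<open>metric_entropy\<close>, so all four agree.\<close>
  ultimately have "metric_entropy X f \<mu> = (SUP k. ?h k)" "liminf ?h = metric_entropy X f \<mu>"
    "limsup ?h = metric_entropy X f \<mu>"
    by order+
  then show ?thesis
    by (auto intro: Liminf_eq_Limsup)
qed

end
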